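(* Consider a network represented by an undirected graph, with a correct source node broadcasting an information $m$, some set of Byzantine nodes, and all correct nodes running the trigger protocol with parameter $H \geq 1$. Let $D$ be the smallest hop distance between two distinct Byzantine nodes, and suppose that $D \geq H+2$. Let $S$ be a reliable node set, and let $p \notin S$ be a node with a neighbor $q \in S$. If there exists a correct path of $H$ hops or less between $p$ and a node $v \in S$, all nodes of the path being distinct from $q$, then $S \cup \{p\}$ is also a reliable node set.
   Context: **Network.** The network is an undirected graph $(G,E)$; $G$ is the set of nodes (each with a unique identifier) and $E$ the neighborhood relation. A node can send messages only to its neighbors. Each node is either correct (it follows the protocol below) or Byzantine (it behaves arbitrarily, sending arbitrary messages to its neighbors at any time). A distinguished node, the source, is correct; its identity is known. Correct nodes do not know which nodes are Byzantine. To multicast a message is to send it to all one's neighbors. **Execution model.** Message passing is asynchronous: every message sent is eventually received, after an arbitrary finite delay, and in an infinite execution every process is activated infinitely often, in arbitrary order. Channels are authenticated: when a node receives a message from a neighbor $q$, it knows that $q$ sent it (so a Byzantine node cannot lie about its identity to its direct neighbors, but it can put arbitrary content in its messages). An execution is any sequence of events compatible with these rules, the protocol at correct nodes, and arbitrary behavior of Byzantine nodes. **Protocol (parameter $H \geq 1$ known to all correct nodes).** There are standard messages $(m)$ and trigger messages $(m,S)$, where $S$ is a set of node identifiers. Each correct node keeps two sets $Wait$ and $Trig$, initially empty. Initially the source multicasts $(m)$ and $(m,\emptyset)$, where $m$ is the authentic message (the source is regarded as having delivered $m$). Then each correct node follows three rules (in which $m$ stands for an arbitrary message content): - RECEPTION: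 when a standard message $(m)$ is received from a neighbor $q$: if $q$ is the source, deliver $m$, then multicast $(m)$ and $(m,\emptyset)$; otherwise add $(m,q)$ to $Wait$. - TRANSMISSION: when a trigger message $(m,S)$ is received from a neighbor $q$: if $q \notin S$ and $|S| \leq H-1$, add $(m,S\cup\{q\})$ to $Trig$ and multicast $(m,S\cup\{q\})$. - DECISION: when there exist $m,q,S$ with $(m,q)\in Wait$, $(m,S)\in Trig$ and $q\notin S$: deliver $m$, then multicast $(m)$ and $(m,\emptyset)$. **Distance $D$.** $D$ is the smallest number of hops (graph distance) between two distinct Byzantine nodes; if there are fewer than two Byzantine nodes, $D=\infty$. **Reliable node set.** For a given source node and a given distribution of Byzantine nodes, a set $S$ of correct nodes is reliable if all nodes in $S$ eventually deliver the authentic message in any possible execution. **Correct path.** An $N$-hops correct path is a sequence of distinct correct nodes $(p_0,\dots,p_N)$ such that $p_i$ and $p_{i+1}$ are neighbors for all $i \leq N-1$. *)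

theory Defs
  imports Main "HOL-Library.Multiset" "HOL-Library.Extended_Nat"
begin

definition undirected_graph :: "'v set \<Rightarrow> ('v \<times> 'v) set \<Rightarrow> bool" where
  "undirected_graph G E \<longleftrightarrow> E \<subseteq> G \<times> G \<and> sym E \<and> irrefl E"

text \<open>An infimum over the empty set is \<open>\<infinity>\<close> in \<^typ>\<open>enat\<close>: this covers unconnected nodes in
  \<open>hop_dist\<close> and fewer than two Byzantine nodes in \<open>byz_dist\<close>.\<close>

definition hop_dist :: "('v \<times> 'v) set \<Rightarrow> 'v \<Rightarrow> 'v \<Rightarrow> enat" where
  "hop_dist E u v = Inf {enat n |n. (u, v) \<in> E ^^ n}"

definition byz_dist :: "('v \<times> 'v) set \<Rightarrow> 'v set \<Rightarrow> enat" where
  "byz_dist E B = Inf {hop_dist E u v |u v. u \<in> B \<and> v \<in> B \<and> u \<noteq> v}"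

definition correct_path ::
  "'v set \<Rightarrow> ('v \<times> 'v) set \<Rightarrow> 'v set \<Rightarrow> nat \<Rightarrow> 'v list \<Rightarrow> bool" where
  "correct_path G E B N ps \<longleftrightarrow>
     length ps = N + 1 \<and> distinct ps \<and> set ps \<subseteq> G - B \<and>
     (\<forall>i < N. (ps ! i, ps ! (i + 1)) \<in> E)"

text \<open>\<open>Std c\<close> is the standard message $(c)$ and \<open>Trg c T\<close> the trigger message $(c,T)$.\<close>

datatype ('v, 'm) message = Std 'm | Trg 'm "'v set"

record ('v, 'm) local_state =
  wait :: "('m \<times> 'v) set"
  trig :: "('m \<times> 'v set) set"
  delivered :: "'m set"

text \<open>\<open>chan s u v\<close> is the multiset of messages sent by \<open>u\<close> to \<open>v\<close> and not yet received.
  Channels are authenticated because the receiver sees the index \<open>u\<close>; they are not FIFO.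
  The local states of Byzantine nodes are meaningless.\<close>

record ('v, 'm) config =
  loc :: "'v \<Rightarrow> ('v, 'm) local_state"
  chan :: "'v \<Rightarrow> 'v \<Rightarrow> ('v, 'm) message multiset"

definition multicast ::
  "('v \<times> 'v) set \<Rightarrow> 'v \<Rightarrow> ('v, 'm) message multiset \<Rightarrow> ('v, 'm) config \<Rightarrow> ('v, 'm) config" where
  "multicast E u M s =
     s\<lparr>chan := (\<lambda>u' w. chan s u' w + (if u' = u \<and> (u, w) \<in> E then M else {#}))\<rparr>"

definition set_loc ::
  "'v \<Rightarrow> ('v, 'm) local_state \<Rightarrow> ('v, 'm) config \<Rightarrow> ('v, 'm) config" where
  "set_loc v st s = s\<lparr>loc := (loc s)(v := st)\<rparr>"

definition send ::
  "'v \<Rightarrow> 'v \<Rightarrow> ('v, 'm) message \<Rightarrow> ('v, 'm) config \<Rightarrow> ('v, 'm) config" where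
  "send u v x s = s\<lparr>chan := (chan s)(u := (chan s u)(v := add_mset x (chan s u v)))\<rparr>"

definition remove ::
  "'v \<Rightarrow> 'v \<Rightarrow> ('v, 'm) message \<Rightarrow> ('v, 'm) config \<Rightarrow> ('v, 'm) config" where
  "remove u v x s = s\<lparr>chan := (chan s)(u := (chan s u)(v := chan s u v - {#x#}))\<rparr>"

definition deliver ::
  "('v \<times> 'v) set \<Rightarrow> 'v \<Rightarrow> 'm \<Rightarrow> ('v, 'm) config \<Rightarrow> ('v, 'm) config" where
  "deliver E v c s =
     multicast E v {#Std c, Trg c {}#}
       (set_loc v ((loc s v)\<lparr>delivered := insert c (delivered (loc s v))\<rparr>) s)"

text \<open>RECEPTION and TRANSMISSION at a correct node \<open>v\<close>, for a message coming from \<open>q\<close>. The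
  test \<open>finite T\<close> is needed because \<^const>\<open>card\<close> is \<open>0\<close> on infinite sets, which a Byzantine
  node might send.\<close>

fun handle ::
  "('v \<times> 'v) set \<Rightarrow> 'v \<Rightarrow> nat \<Rightarrow> 'v \<Rightarrow> 'v \<Rightarrow> ('v, 'm) message
     \<Rightarrow> ('v, 'm) config \<Rightarrow> ('v, 'm) config" where
  "handle E src H q v (Std c) s =
     (if q = src then deliver E v c s
      else set_loc v ((loc s v)\<lparr>wait := insert (c, q) (wait (loc s v))\<rparr>) s)"
| "handle E src H q v (Trg c T) s =
     (if q \<notin> T \<and> finite T \<and> card T \<le> H - 1
      then multicast E v {#Trg c (T \<union> {q})#}
             (set_loc v ((loc s v)\<lparr>trig := insert (c, T \<union> {q}) (trig (loc s v))\<rparr>) s)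
      else s)"

definition can_decide :: "('v, 'm) local_state \<Rightarrow> 'm \<Rightarrow> bool" where
  "can_decide st c \<longleftrightarrow> (\<exists>q T. (c, q) \<in> wait st \<and> (c, T) \<in> trig st \<and> q \<notin> T)"

definition init_config :: "('v \<times> 'v) set \<Rightarrow> 'v \<Rightarrow> 'm \<Rightarrow> ('v, 'm) config" where
  "init_config E src m =
     deliver E src m
       \<lparr>loc = (\<lambda>_. \<lparr>wait = {}, trig = {}, delivered = {}\<rparr>), chan = (\<lambda>_ _. {#})\<rparr>"

text \<open>\<open>Receive u v x\<close>: node \<open>v\<close> receives \<open>x\<close> from \<open>u\<close>. \<open>Decide v c\<close>: \<open>v\<close> applies DECISION to
  \<open>c\<close>. \<open>Byz_Send b v x\<close>: a Byzantine node \<open>b\<close> sends \<open>x\<close> to its neighbor \<open>v\<close>. \<open>Idle\<close> is an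
  activation without effect; it makes executions infinite even when nothing is left to do.\<close>

datatype ('v, 'm) event =
    Receive 'v 'v "('v, 'm) message"
  | Decide 'v 'm
  | Byz_Send 'v 'v "('v, 'm) message"
  | Idle

inductive step ::
  "'v set \<Rightarrow> ('v \<times> 'v) set \<Rightarrow> 'v set \<Rightarrow> 'v \<Rightarrow> nat
     \<Rightarrow> ('v, 'm) config \<Rightarrow> ('v, 'm) event \<Rightarrow> ('v, 'm) config \<Rightarrow> bool"
  for G E B src H where
  receive_correct:
    "v \<in> G - B \<Longrightarrow> x \<in># chan s u v \<Longrightarrow>
     step G E B src H s (Receive u v x) (handle E src H u v x (remove u v x s))"
| receive_byz:
    "v \<in> B \<Longrightarrow> x \<in># chan s u v \<Longrightarrow>
     step G E B src H s (Receive u v x) (remove u v x s)"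
| decide:
    "v \<in> G - B \<Longrightarrow> can_decide (loc s v) c \<Longrightarrow>
     step G E B src H s (Decide v c) (deliver E v c s)"
| byz_send:
    "b \<in> B \<Longrightarrow> (b, v) \<in> E \<Longrightarrow>
     step G E B src H s (Byz_Send b v x) (send b v x s)"
| idle:
    "step G E B src H s Idle s"

text \<open>The third conjunct says that every message sent is eventually received (for identical
  copies on one channel: as many receptions as copies, since it holds again at each later
  time). The last one expresses that processes are activated infinitely often: a
  DECISION that has become possible, and hence stays possible because \<^const>\<open>wait\<close> and
  \<^const>\<open>trig\<close> only grow, is eventually carried out. It may be repeated but need not be.\<close>

definition execution ::
  "'v set \<Rightarrow> ('v \<times> 'v) set \<Rightarrow> 'v set \<Rightarrow> 'v \<Rightarrow> 'm \<Rightarrow> nat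
     \<Rightarrow> (nat \<Rightarrow> ('v, 'm) config) \<Rightarrow> (nat \<Rightarrow> ('v, 'm) event) \<Rightarrow> bool" where
  "execution G E B src m H \<sigma> ev \<longleftrightarrow>
     \<sigma> 0 = init_config E src m \<and>
     (\<forall>t. step G E B src H (\<sigma> t) (ev t) (\<sigma> (Suc t))) \<and>
     (\<forall>t u v x. x \<in># chan (\<sigma> t) u v \<longrightarrow> (\<exists>t' \<ge> t. ev t' = Receive u v x)) \<and>
     (\<forall>t. \<forall>v \<in> G - B. \<forall>c. can_decide (loc (\<sigma> t) v) c \<longrightarrow> (\<exists>t'. ev t' = Decide v c))"

definition reliable ::
  "'v set \<Rightarrow> ('v \<times> 'v) set \<Rightarrow> 'v set \<Rightarrow> 'v \<Rightarrow> 'm \<Rightarrow> nat \<Rightarrow> 'v set \<Rightarrow> bool" where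
  "reliable G E B src m H S \<longleftrightarrow>
     S \<subseteq> G - B \<and>
     (\<forall>\<sigma> ev. execution G E B src m H \<sigma> ev \<longrightarrow>
        (\<forall>v \<in> S. \<exists>t. m \<in> delivered (loc (\<sigma> t) v)))"

end

theory Submission
  imports Defs
begin

text \<open>Once \<open>q\<close> has delivered \<open>m\<close>, its standard message makes \<open>p\<close> deliver at once (if \<open>q\<close> is the
  source) or puts \<open>(m, q)\<close> into the \<open>Wait\<close> set of \<open>p\<close> for good. Once \<open>v\<close> has delivered \<open>m\<close>, its
  trigger message travels along the correct path, collecting the nodes it visits, and reaches
  \<open>p\<close> with a set that avoids \<open>q\<close>. The two together enable DECISION at \<open>p\<close>.\<close>

lemma loc_multicast [simp]: "loc (multicast E u M s) = loc s"
  by (simp add: multicast_def)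

lemma loc_set_loc [simp]: "loc (set_loc u st s) = (loc s)(u := st)"
  by (simp add: set_loc_def)

lemma loc_send [simp]: "loc (send u w x s) = loc s"
  by (simp add: send_def)

lemma loc_remove [simp]: "loc (remove u w x s) = loc s"
  by (simp add: remove_def)

lemma loc_deliver [simp]:
  "loc (deliver E u c s) =
     (loc s)(u := (loc s u)\<lparr>delivered := insert c (delivered (loc s u))\<rparr>)"
  by (simp add: deliver_def)

lemma multicast_in_chan:
  "x \<in># M \<Longrightarrow> (u, w) \<in> E \<Longrightarrow> x \<in># chan (multicast E u M s) u w"
  by (simp add: multicast_def)

lemma deliver_in_chan:
  assumes "(u, w) \<in> E" and "x \<in> {Std c, Trg c {}}"
  shows "x \<in># chan (deliver E u c s) u w"
  unfolding deliver_def by (rule multicast_in_chan) (use assms in auto)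

lemma handle_mono:
  "wait (loc s u) \<subseteq> wait (loc (handle E src H q w x s) u)
   \<and> trig (loc s u) \<subseteq> trig (loc (handle E src H q w x s) u)"
  by (cases x) auto

text \<open>Only a standard message coming from the source enlarges \<open>delivered\<close> here,
  and it does so through \<open>deliver\<close>, which puts both messages on every outgoing
  channel.\<close>

lemma handle_delivered:
  assumes "c \<in> delivered (loc (handle E src H q w y s) u)" and "c \<notin> delivered (loc s u)"
    and "(u, u') \<in> E" and "x \<in> {Std c, Trg c {}}"
  shows "x \<in># chan (handle E src H q w y s) u u'"
  using assms by (cases y) (auto intro: deliver_in_chan split: if_splits)

lemma step_mono:
  assumes "step G E B src H s e s'"
  shows "wait (loc s u) \<subseteq> wait (loc s' u) \<and> trig (loc s u) \<subseteq> trig (loc s' u)"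
  using assms
proof cases
  case (receive_correct w x q)
  then show ?thesis using handle_mono[of "remove q w x s"] by simp
qed auto

lemma step_delivered:
  assumes "step G E B src H s e s'"
    and "c \<in> delivered (loc s' u)" and "c \<notin> delivered (loc s u)"
    and "(u, w) \<in> E" and "x \<in> {Std c, Trg c {}}"
  shows "x \<in># chan s' u w"
  using assms(1)
proof cases
  case (receive_correct w' y q)
  then show ?thesis
    using handle_delivered[of c E src H q w' y "remove q w' y s" u w x] assms by simp
next
  case (decide w' c')
  then have "u = w' \<and> c' = c"
    using assms(2,3) by (auto split: if_splits)
  then show ?thesis
    using decide deliver_in_chan assms(4,5) by metis
qed (use assms in auto)

lemma execution_stepD:
  "execution G E B src m H \<sigma> ev \<Longrightarrow> step G E B src H (\<sigma> t) (ev t) (\<sigma> (Suc t))"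
  by (simp add: execution_def)

lemma execution_mono:
  assumes "execution G E B src m H \<sigma> ev" and "t \<le> t'"
  shows "wait (loc (\<sigma> t) u) \<subseteq> wait (loc (\<sigma> t') u) \<and> trig (loc (\<sigma> t) u) \<subseteq> trig (loc (\<sigma> t') u)"
  using assms(2)
proof (induction rule: dec_induct)
  case (step n)
  then show ?case
    using step_mono[OF execution_stepD[OF assms(1), of n], of u] by blast
qed simp

text \<open>Both messages are in the channel at the moment of the first delivery. They may be
  received later, so the time \<open>t'\<close> is in general not \<open>t\<close>.\<close>

lemma execution_delivered_sent:
  assumes "execution G E B src m H \<sigma> ev"
    and "c \<in> delivered (loc (\<sigma> t) u)" and "(u, w) \<in> E" and "x \<in> {Std c, Trg c {}}"
  shows "\<exists>t'. x \<in># chan (\<sigma> t') u w"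
  using assms(2)
proof (induction t)
  case 0
  have init: "\<sigma> 0 = init_config E src m"
    using assms(1) by (simp add: execution_def)
  \<comment> \<open>At time 0 only the source has delivered anything; \<open>init_config\<close> is
    itself a \<open>deliver\<close> at \<open>src\<close>, so its messages are already in the
    channels.\<close>
  with 0 have "u = src \<and> c = m"
    by (auto simp: init_config_def split: if_splits)
  with init show ?case
    unfolding init_config_def using deliver_in_chan assms(3,4) by metis
next
  case (Suc t)
  then show ?case
    using step_delivered[OF execution_stepD[OF assms(1)] _ _ assms(3,4)] by blast
qed

text \<open>Fairness of the channels yields the \<open>Receive\<close> event; as \<open>w\<close> is
  correct, the event must run \<open>handle\<close> and cannot be a mere removal by a Byzantine
  node.\<close>

lemma execution_received:
  assumes "execution G E B src m H \<sigma> ev" and "w \<in> G - B" and "x \<in># chan (\<sigma> t) u w"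
  obtains t' where "\<sigma> (Suc t') = handle E src H u w x (remove u w x (\<sigma> t'))"
proof -
  obtain t' where "ev t' = Receive u w x"
    using assms(1,3) unfolding execution_def by blast
  with execution_stepD[OF assms(1), of t']
  have "step G E B src H (\<sigma> t') (Receive u w x) (\<sigma> (Suc t'))"
    by simp
  then show thesis
    using assms(2) that by cases auto
qed

lemma execution_decided:
  assumes "execution G E B src m H \<sigma> ev" and "w \<in> G - B" and "can_decide (loc (\<sigma> t) w) c"
  shows "\<exists>t'. c \<in> delivered (loc (\<sigma> t') w)"
proof -
  obtain t' where "ev t' = Decide w c"
    using assms unfolding execution_def by blast
  with execution_stepD[OF assms(1), of t']
  have "step G E B src H (\<sigma> t') (Decide w c) (\<sigma> (Suc t'))"
    by simp
  then have "c \<in> delivered (loc (\<sigma> (Suc t')) w)"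
    by cases auto
  then show ?thesis ..
qed

lemma execution_trigger_relayed:
  assumes "execution G E B src m H \<sigma> ev" and "w \<in> G - B" and "Trg c T \<in># chan (\<sigma> t) u w"
    and "u \<notin> T" and "finite T" and "card T \<le> H - 1"
  obtains t' where "(c, insert u T) \<in> trig (loc (\<sigma> t') w)"
    and "\<And>w'. (w, w') \<in> E \<Longrightarrow> Trg c (insert u T) \<in># chan (\<sigma> t') w w'"
proof -
  obtain t' where t': "\<sigma> (Suc t') = handle E src H u w (Trg c T) (remove u w (Trg c T) (\<sigma> t'))"
    using execution_received[OF assms(1-3)] .
  show thesis
    by (rule that[of "Suc t'"]) (use assms(4-6) in \<open>auto simp: t' intro: multicast_in_chan\<close>)
qed

text \<open>The path is listed against the direction of travel: \<open>last (a # as)\<close> has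
  delivered \<open>c\<close>, and \<open>a\<close> currently forwards the trigger message. The nodes
  behind \<open>a\<close> are exactly those collected so far, so distinctness and the length bound
  pass the tests of TRANSMISSION. The target \<open>w\<close> is an arbitrary neighbor of
  \<open>a\<close>, so the induction can extend the path at its head.\<close>

lemma execution_trigger_along_path:
  assumes "execution G E B src m H \<sigma> ev" and "sym E"
    and "c \<in> delivered (loc (\<sigma> t) (last (a # as)))"
    and "distinct (a # as)" and "set (a # as) \<subseteq> G - B"
    and "successively (\<lambda>x y. (x, y) \<in> E) (a # as)" and "length as \<le> H"
    and "(a, w) \<in> E"
  shows "\<exists>t. Trg c (set as) \<in># chan (\<sigma> t) a w"
  using assms(3-8)
proof (induction as arbitrary: a w)
  case Nil
  then show ?case
    using execution_delivered_sent[OF assms(1), of c t a w] by simp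
next
  case (Cons b bs)
  have "(b, a) \<in> E"
    using Cons.prems(4) assms(2) by (auto dest: symD)
  then obtain t' where "Trg c (set bs) \<in># chan (\<sigma> t') b a"
    using Cons.IH[of b a] Cons.prems by auto
  moreover have a: "a \<in> G - B" "b \<notin> set bs"
    using Cons.prems(2,3) by auto
  \<comment> \<open>The path behind \<open>a\<close> is \<open>b # bs\<close>, of length at most
    \<open>H\<close>; the sender \<open>b\<close> is not yet in the set that \<open>a\<close>
    tests.\<close>
  moreover have "card (set bs) \<le> H - 1"
    using Cons.prems(5) card_length[of bs] by simp
  ultimately obtain t'' where "Trg c (insert b (set bs)) \<in># chan (\<sigma> t'') a w"
    using execution_trigger_relayed[OF assms(1) _ _ _ finite_set] a Cons.prems(6) by metis
  then show ?case by auto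
qed

theorem theorem3:
  fixes G :: "'v set" and E :: "('v \<times> 'v) set" and B :: "'v set"
    and src :: 'v and m :: 'm and H :: nat
    and S :: "'v set" and p q v :: 'v and N :: nat and ps :: "'v list"
  assumes "undirected_graph G E"
    and "B \<subseteq> G"
    and "src \<in> G - B"
    and "H \<ge> 1"
    and "byz_dist E B \<ge> enat (H + 2)"
    and "reliable G E B src m H S"
    and "p \<in> G" and "p \<notin> S"
    and "q \<in> S" and "(p, q) \<in> E"
    and "v \<in> S"
    and "correct_path G E B N ps" and "N \<le> H"
    and "hd ps = p" and "last ps = v"
    and "q \<notin> set ps"
  shows "reliable G E B src m H (S \<union> {p})"
proof -
  have sym: "sym E"
    using assms(1) by (simp add: undirected_graph_def)
  have path: "length ps = N + 1" "distinct ps" "set ps \<subseteq> G - B"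
    and edges: "successively (\<lambda>x y. (x, y) \<in> E) ps"
    using assms(12) by (auto simp: correct_path_def successively_conv_nth)
  have "p \<noteq> v"
    using assms(8,11) by blast
  \<comment> \<open>\<open>b\<close> is the neighbor through which the trigger message will reach
    \<open>p\<close>.\<close>
  then obtain b bs where ps: "ps = p # b # bs"
    using path(1) assms(14,15) by (cases ps; cases "tl ps") auto
  have p: "p \<in> G - B"
    using path(3) ps by simp
  have "\<exists>t. m \<in> delivered (loc (\<sigma> t) p)" if ex: "execution G E B src m H \<sigma> ev" for \<sigma> ev
  proof -
    obtain tq tv where tq: "m \<in> delivered (loc (\<sigma> tq) q)" and tv: "m \<in> delivered (loc (\<sigma> tv) v)"
      using assms(6,9,11) ex unfolding reliable_def by meson
    have "(q, p) \<in> E"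
      using assms(10) sym by (auto dest: symD)
    then obtain t0 where "Std m \<in># chan (\<sigma> t0) q p"
      using execution_delivered_sent[OF ex tq] by blast
    then obtain t1 where t1: "\<sigma> (Suc t1) = handle E src H q p (Std m) (remove q p (Std m) (\<sigma> t1))"
      using execution_received[OF ex p] by blast
    show ?thesis
    proof (cases "q = src")
      case True
      then have "m \<in> delivered (loc (\<sigma> (Suc t1)) p)"
        by (simp add: t1)
      then show ?thesis ..
    next
      case False
      then have wait: "(m, q) \<in> wait (loc (\<sigma> (Suc t1)) p)"
        by (simp add: t1)
      have "(b, p) \<in> E"
        using edges sym ps by (auto dest: symD)
      then obtain t2 where "Trg m (set bs) \<in># chan (\<sigma> t2) b p"
        using execution_trigger_along_path[OF ex sym, of m tv b bs p] tv path edges ps assms(13,15)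
        by auto
      \<comment> \<open>\<open>bs\<close> omits both \<open>p\<close> and \<open>b\<close> from the
        \<open>N + 1\<close> nodes of the path, so it has length \<open>N - 1\<close>; here
        \<open>N \<le> H\<close> is exactly what the test at \<open>p\<close> requires.\<close>
      moreover have "card (set bs) \<le> H - 1"
        using path(1) ps assms(13) card_length[of bs] by simp
      ultimately obtain t3 where trig: "(m, insert b (set bs)) \<in> trig (loc (\<sigma> t3) p)"
        using execution_trigger_relayed[OF ex p, of m "set bs" t2 b] path(2) ps by auto
      \<comment> \<open>The two entries may arrive in either order; since \<open>wait\<close> and
        \<open>trig\<close> only grow, both are present at the later time.\<close>
      have "can_decide (loc (\<sigma> (max (Suc t1) t3)) p) m"
        unfolding can_decide_def
      proof (intro exI conjI)
        show "(m, q) \<in> wait (loc (\<sigma> (max (Suc t1) t3)) p)"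
          using wait execution_mono[OF ex max.cobounded1] by blast
        show "(m, insert b (set bs)) \<in> trig (loc (\<sigma> (max (Suc t1) t3)) p)"
          using trig execution_mono[OF ex max.cobounded2] by blast
        show "q \<notin> insert b (set bs)"
          using assms(16) ps by simp
      qed
      then show ?thesis
        by (rule execution_decided[OF ex p])
    qed
  qed
  then show ?thesis
    using assms(6) p by (auto simp: reliable_def)
qed

end
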